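(* Let $$M_W=T\cdot\Sigma_W=\frac{1}{360}\left(\begin{array}{cccccc} 46&-23&-23&7&7&-14\\ -23&28&10&-20&-2&7\\ -23&10&28&-2&-20&7\\ 7&-20&-2&28&10&-23\\ 7&-2&-20&10&28&-23\\ -14&7&7&-23&-23&46 \end{array}\right)$$ be the ($T$-scaled) asymptotic covariance matrix of pattern frequencies of white noise (an i.i.d. process). Then the vectors $\overline{\tau}$ and $\overline{\gamma}$ of the pattern contrasts $\tau$ and $\gamma$ are eigenvectors of $M_W$ for the eigenvalues $\frac{2}{15}$ and $\frac{1}{10}$, respectively. The other two eigenvectors of nonzero eigenvalues of $M_W$ generate the same plane as $\overline{\beta}$ and $\overline{\delta}$. The contrasts $\beta$ and $\delta$ have correlation $$\mathrm{corr}(\beta,\delta)=-\frac{\sqrt2}{2},$$ and all other pairs of the four estimators $\beta,\tau,\gamma,\delta$ are uncorrelated.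
   Context: Rows and columns of the matrix and coordinates of $\mathbb{R}^6$ are indexed by the permutations $123,132,213,231,312,321$ in this order. The (row) vectors of the four pattern contrasts are $$\overline{\beta}=(1,0,0,0,0,-1),\quad \overline{\tau}=\left(\tfrac23,-\tfrac13,-\tfrac13,-\tfrac13,-\tfrac13,\tfrac23\right),$$ $$\overline{\gamma}=(0,-1,1,1,-1,0),\quad \overline{\delta}=(0,1,1,-1,-1,0).$$ $T$ is the length of the sample series. For linear combinations of pattern frequencies given by row vectors $x,y\in\mathbb{R}^6$, the $T$-scaled (asymptotic) covariance is by definition $xM_Wy'$, where $y'$ is the transpose; the correlation is $\dfrac{xM_Wy'}{\sqrt{xM_Wx'}\sqrt{yM_Wy'}}$, and $x,y$ are uncorrelated if $xM_Wy'=0$. Covariances and correlations of $\beta,\tau,\gamma,\delta$ are those of the corresponding vectors $\overline\beta,\overline\tau,\overline\gamma,\overline\delta$. *)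

theory Defs
  imports "HOL-Analysis.Analysis"
begin

text \<open>Order patterns of length three; \<open>P132\<close> is the permutation 132 in one-line notation.\<close>

datatype pattern = P123 | P132 | P213 | P231 | P312 | P321

instance pattern :: finite
proof
  have "(UNIV :: pattern set) = {P123, P132, P213, P231, P312, P321}"
    using pattern.exhaust by auto
  then show "finite (UNIV :: pattern set)"
    by (metis finite.emptyI finite.insertI)
qed

primrec pos :: "pattern \<Rightarrow> nat" where
  "pos P123 = 0"
| "pos P132 = 1"
| "pos P213 = 2"
| "pos P231 = 3"
| "pos P312 = 4"
| "pos P321 = 5"

definition vec6 :: "real list \<Rightarrow> real ^ pattern" where
  "vec6 xs = (\<chi> i. xs ! pos i)"

definition mat6 :: "real list list \<Rightarrow> real ^ pattern ^ pattern" where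
  "mat6 rs = (\<chi> i j. rs ! pos i ! pos j)"

definition white_noise_matrix :: "real ^ pattern ^ pattern" where
  "white_noise_matrix = (1 / 360) *\<^sub>R mat6
    [[ 46, -23, -23,   7,   7, -14],
     [-23,  28,  10, -20,  -2,   7],
     [-23,  10,  28,  -2, -20,   7],
     [  7, -20,  -2,  28,  10, -23],
     [  7,  -2, -20,  10,  28, -23],
     [-14,   7,   7, -23, -23,  46]]"

definition beta_vec :: "real ^ pattern" where
  "beta_vec = vec6 [1, 0, 0, 0, 0, -1]"

definition tau_vec :: "real ^ pattern" where
  "tau_vec = vec6 [2/3, -1/3, -1/3, -1/3, -1/3, 2/3]"

definition gamma_vec :: "real ^ pattern" where
  "gamma_vec = vec6 [0, -1, 1, 1, -1, 0]"

definition delta_vec :: "real ^ pattern" where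
  "delta_vec = vec6 [0, 1, 1, -1, -1, 0]"

definition eigenvector :: "real ^ 'n ^ 'n \<Rightarrow> real ^ 'n \<Rightarrow> real \<Rightarrow> bool" where
  "eigenvector A v c \<longleftrightarrow> v \<noteq> 0 \<and> A *v v = c *\<^sub>R v"

definition eigenvalue :: "real ^ 'n ^ 'n \<Rightarrow> real \<Rightarrow> bool" where
  "eigenvalue A c \<longleftrightarrow> (\<exists>v. eigenvector A v c)"

definition eigenspace :: "real ^ 'n ^ 'n \<Rightarrow> real \<Rightarrow> (real ^ 'n) set" where
  "eigenspace A c = {v. A *v v = c *\<^sub>R v}"

text \<open>The number \<open>x M y'\<close>, for row vectors \<open>x\<close> and \<open>y\<close>.\<close>

definition covariance :: "real ^ 'n ^ 'n \<Rightarrow> real ^ 'n \<Rightarrow> real ^ 'n \<Rightarrow> real" where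
  "covariance M x y = (x v* M) \<bullet> y"

definition correlation :: "real ^ 'n ^ 'n \<Rightarrow> real ^ 'n \<Rightarrow> real ^ 'n \<Rightarrow> real" where
  "correlation M x y =
     covariance M x y / (sqrt (covariance M x x) * sqrt (covariance M y y))"

definition uncorrelated :: "real ^ 'n ^ 'n \<Rightarrow> real ^ 'n \<Rightarrow> real ^ 'n \<Rightarrow> bool" where
  "uncorrelated M x y \<longleftrightarrow> covariance M x y = 0"

end

theory Submission
  imports Defs
begin

text \<open>
  The matrix \<open>M\<close> is symmetric, and it has six pairwise orthogonal eigenvectors that can be written
  down explicitly, so its whole spectral decomposition is known. On the plane of \<open>\<beta>\<close> and \<open>\<delta>\<close> it acts by
  \<open>12 M \<beta> = 2 \<beta> - \<delta>\<close> and \<open>6 M \<delta> = \<delta> - \<beta>\<close>, so that plane is invariant and splits into the lines of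
  \<open>\<surd>2 \<beta> - \<delta>\<close> and \<open>\<surd>2 \<beta> + \<delta>\<close>, with eigenvalues \<open>(2 \<plusminus> \<surd>2) / 12\<close>. The contrasts \<open>\<tau>\<close> and \<open>\<gamma>\<close> are
  eigenvectors themselves, and the kernel is spanned by \<open>(1,1,1,1,1,1)\<close> and \<open>(0,1,-1,1,-1,0)\<close>: every
  covariance matrix of frequencies kills the former since the frequencies add up to \<open>1\<close>, and the latter
  is what remains in the orthogonal complement of the other five.

  Expanding a vector in this basis shows that there are no further eigenvalues and that
  each eigenspace is spanned by the basis vectors with its eigenvalue
  (\<open>eigenspace_orthogonal_eigenbasis\<close>). The four nonzero eigenvalues
  are distinct, so their eigenspaces are lines, and any eigenvectors for the last two are multiples
  of \<open>\<surd>2 \<beta> \<minusplus> \<delta>\<close>, which span the same plane as \<open>\<beta>\<close> and \<open>\<delta>\<close>.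

  For the correlations, the four contrasts are orthogonal to each other, so
  an eigenvector among them is uncorrelated with the others. The remaining numbers are
  \<open>var \<beta> = 1/3\<close>, \<open>var \<delta> = 2/3\<close> and \<open>cov(\<beta>, \<delta>) = -1/3\<close>, read off from the action on the plane.
\<close>

section \<open>Symmetric matrices with an orthogonal eigenbasis\<close>

text \<open>
  Eigenvectors of a symmetric matrix for different eigenvalues are orthogonal. So, in the orthogonal
  expansion of an eigenvector, only basis vectors with the same eigenvalue occur. Indexing the
  family by the coordinate type says that it has as many members as the dimension, hence spans.
\<close>

lemma eigenspace_orthogonal_eigenbasis:
  fixes A :: "real ^ 'n ^ 'n" and w :: "'n \<Rightarrow> real ^ 'n" and l :: "'n \<Rightarrow> real"
  assumes sym: "transpose A = A"
    and eig: "\<And>i. eigenvector A (w i) (l i)"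
    and orth: "\<And>i j. i \<noteq> j \<Longrightarrow> w i \<bullet> w j = 0"
  shows "eigenspace A c = span (w ` {i. l i = c})"
proof
  have w0: "w i \<noteq> 0" and Aw: "A *v w i = l i *\<^sub>R w i" for i
    using eig[of i] by (auto simp: eigenvector_def)
  have inj: "inj w"
    by (metis injI inner_eq_zero_iff orth w0)
  have pw: "pairwise orthogonal (range w)"
    by (auto simp: pairwise_def orthogonal_def intro: orth)
  have "independent (range w)"
    using pairwise_orthogonal_independent[OF pw] w0 by (metis imageE)
  moreover have "card (range w) = DIM(real ^ 'n)"
    using inj by (simp add: card_image)
  ultimately have spans: "span (range w) = UNIV"
    by (metis card_eq_dim dim_UNIV finite finite_imageI span_UNIV span_subspace subset_UNIV
        subspace_UNIV top.extremum_uniqueI)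
  show "eigenspace A c \<subseteq> span (w ` {i. l i = c})"
  proof
    fix v assume "v \<in> eigenspace A c"
    then have Av: "A *v v = c *\<^sub>R v" by (simp add: eigenspace_def)
    have ortho: "w i \<bullet> v = 0" if "l i \<noteq> c" for i
    proof -
      have "(w i v* A) \<bullet> v = w i \<bullet> (A *v v)" by (rule dot_lmul_matrix)
      moreover have "w i v* A = A *v w i" by (metis sym transpose_matrix_vector)
      ultimately have "l i * (w i \<bullet> v) = c * (w i \<bullet> v)" by (simp add: Av Aw)
      with that show ?thesis by simp
    qed
    define p where "p = (\<Sum>b\<in>range w. (b \<bullet> v / (b \<bullet> b)) *\<^sub>R b)"
    have "orthogonal x (v - p)" for x
      unfolding p_def using Gram_Schmidt_step[OF pw] spans by blast
    then have "v = p" by (metis eq_iff_diff_eq_0 orthogonal_self)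
    moreover have "p \<in> span (w ` {i. l i = c})"
      unfolding p_def
    proof (rule span_sum)
      fix b assume "b \<in> range w"
      then obtain i where b: "b = w i" by blast
      show "(b \<bullet> v / (b \<bullet> b)) *\<^sub>R b \<in> span (w ` {i. l i = c})"
      proof (cases "l i = c")
        case True
        then show ?thesis by (simp add: b span_base span_scale)
      next
        case False
        then show ?thesis by (simp add: b ortho span_zero)
      qed
    qed
    ultimately show "v \<in> span (w ` {i. l i = c})" by simp
  qed
  have "subspace (eigenspace A c)"
    by (auto simp: eigenspace_def subspace_def matrix_vector_right_distrib
        matrix_vector_mult_scaleR scaleR_right_distrib)
  then show "span (w ` {i. l i = c}) \<subseteq> eigenspace A c"
    by (intro span_minimal) (auto simp: eigenspace_def Aw)
qed

corollary eigenvalues_orthogonal_eigenbasis: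
  fixes A :: "real ^ 'n ^ 'n" and w :: "'n \<Rightarrow> real ^ 'n" and l :: "'n \<Rightarrow> real"
  assumes "transpose A = A"
    and eig: "\<And>i. eigenvector A (w i) (l i)"
    and "\<And>i j. i \<noteq> j \<Longrightarrow> w i \<bullet> w j = 0"
  shows "{c. eigenvalue A c} = range l"
proof
  show "{c. eigenvalue A c} \<subseteq> range l"
  proof
    fix c assume "c \<in> {c. eigenvalue A c}"
    then obtain v where "v \<noteq> 0" "v \<in> eigenspace A c"
      by (auto simp: eigenvalue_def eigenvector_def eigenspace_def)
    then have "span (w ` {i. l i = c}) \<noteq> {0}"
      using eigenspace_orthogonal_eigenbasis[of A w l c] assms by blast
    then have "{i. l i = c} \<noteq> {}" by force
    then show "c \<in> range l" by blast
  qed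
  show "range l \<subseteq> {c. eigenvalue A c}"
    using eig by (auto simp: eigenvalue_def)
qed

section \<open>Covariances under a symmetric matrix\<close>

lemma covariance_eq_inner:
  "covariance M x y = x \<bullet> (M *v y)"
  by (simp add: covariance_def dot_lmul_matrix)

lemma covariance_commute:
  assumes "transpose M = M"
  shows "covariance M x y = covariance M y x"
  by (metis assms covariance_def covariance_eq_inner inner_commute transpose_matrix_vector)

lemma uncorrelated_eigenvector:
  assumes "eigenvector M y c" "x \<bullet> y = 0"
  shows "uncorrelated M x y"
  using assms by (simp add: uncorrelated_def covariance_eq_inner eigenvector_def)

lemma uncorrelated_commute:
  assumes "transpose M = M"
  shows "uncorrelated M x y \<longleftrightarrow> uncorrelated M y x"
  using covariance_commute[OF assms] by (simp add: uncorrelated_def)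

section \<open>The white noise matrix and the contrasts in coordinates\<close>

lemma UNIV_pattern: "UNIV = {P123, P132, P213, P231, P312, P321}"
  using pattern.exhaust by auto

lemma all_pattern:
  "(\<forall>i. P i) \<longleftrightarrow> P P123 \<and> P P132 \<and> P P213 \<and> P P231 \<and> P P312 \<and> P P321"
  by (metis pattern.exhaust)

lemma sum_pattern:
  "sum f UNIV = f P123 + f P132 + f P213 + f P231 + f P312 + (f P321 :: 'a :: comm_monoid_add)"
  by (simp add: UNIV_pattern add.assoc)

lemmas contrast_defs = beta_vec_def tau_vec_def gamma_vec_def delta_vec_def

lemmas pattern_coordinates =
  vec_eq_iff all_pattern sum_pattern inner_vec_def matrix_vector_mult_def vec6_def mat6_def
  transpose_def white_noise_matrix_def contrast_defs

lemma transpose_white_noise_matrix: "transpose white_noise_matrix = white_noise_matrix"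
  by (simp add: pattern_coordinates)

lemma white_noise_matrix_beta:
  "white_noise_matrix *v beta_vec = (1 / 12) *\<^sub>R (2 *\<^sub>R beta_vec - delta_vec)"
  by (simp add: pattern_coordinates)

lemma white_noise_matrix_delta:
  "white_noise_matrix *v delta_vec = (1 / 6) *\<^sub>R (delta_vec - beta_vec)"
  by (simp add: pattern_coordinates)

lemma eigenvector_tau: "eigenvector white_noise_matrix tau_vec (2 / 15)"
  by (simp add: eigenvector_def pattern_coordinates)

lemma eigenvector_gamma: "eigenvector white_noise_matrix gamma_vec (1 / 10)"
  by (simp add: eigenvector_def pattern_coordinates)

lemma contrasts_inner:
  "beta_vec \<bullet> beta_vec = 2" "delta_vec \<bullet> delta_vec = 4" "beta_vec \<bullet> delta_vec = 0"
  "beta_vec \<bullet> tau_vec = 0" "beta_vec \<bullet> gamma_vec = 0"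
  "delta_vec \<bullet> tau_vec = 0" "delta_vec \<bullet> gamma_vec = 0"
  "tau_vec \<bullet> gamma_vec = 0"
  by (simp_all add: pattern_coordinates)

section \<open>Spectral decomposition of the white noise matrix\<close>

text \<open>
  An orthogonal eigenbasis with its eigenvalues. The patterns serve here only as six labels, and
  which label goes with which eigenvector is arbitrary.
\<close>

primrec eigenbasis :: "pattern \<Rightarrow> real ^ pattern" where
  "eigenbasis P123 = tau_vec"
| "eigenbasis P132 = gamma_vec"
| "eigenbasis P213 = sqrt 2 *\<^sub>R beta_vec - delta_vec"
| "eigenbasis P231 = sqrt 2 *\<^sub>R beta_vec + delta_vec"
| "eigenbasis P312 = vec6 [1, 1, 1, 1, 1, 1]"
| "eigenbasis P321 = vec6 [0, 1, -1, 1, -1, 0]"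

primrec spectrum :: "pattern \<Rightarrow> real" where
  "spectrum P123 = 2 / 15"
| "spectrum P132 = 1 / 10"
| "spectrum P213 = (2 + sqrt 2) / 12"
| "spectrum P231 = (2 - sqrt 2) / 12"
| "spectrum P312 = 0"
| "spectrum P321 = 0"

lemma eigenbasis_eigenvector: "eigenvector white_noise_matrix (eigenbasis i) (spectrum i)"
proof (cases i)
  case P213
  then show ?thesis
    by (simp add: eigenvector_def pattern_coordinates field_simps)
next
  case P231
  then show ?thesis
    by (simp add: eigenvector_def pattern_coordinates field_simps)
qed (simp_all add: eigenvector_tau eigenvector_gamma, simp_all add: eigenvector_def pattern_coordinates)

lemma eigenbasis_orthogonal:
  assumes "i \<noteq> j"
  shows "eigenbasis i \<bullet> eigenbasis j = 0"
  using assms by (cases i; cases j) (simp_all add: pattern_coordinates)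

lemmas white_noise_eigenspace =
  eigenspace_orthogonal_eigenbasis
    [where w = eigenbasis and l = spectrum,
     OF transpose_white_noise_matrix eigenbasis_eigenvector eigenbasis_orthogonal]

lemmas white_noise_eigenvalues =
  eigenvalues_orthogonal_eigenbasis
    [where w = eigenbasis and l = spectrum,
     OF transpose_white_noise_matrix eigenbasis_eigenvector eigenbasis_orthogonal]

text \<open>
  Since \<open>1/10 < 2/15 < 1/4\<close>, these bounds separate the four nonzero eigenvalues from each other and
  from \<open>0\<close>.
\<close>

lemma spectrum_bounds:
  "1 / 4 < spectrum P213" "0 < spectrum P231" "spectrum P231 < 1 / 10"
proof -
  have "1 < sqrt (2 :: real)" "sqrt (2 :: real) < 2"
    by (simp_all add: real_less_lsqrt)
  then show "1 / 4 < spectrum P213" and "0 < spectrum P231" and "spectrum P231 < 1 / 10"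
    unfolding spectrum.simps by argo+
qed

lemma spectrum_inj:
  assumes "spectrum i \<noteq> 0" "spectrum j = spectrum i"
  shows "j = i"
  using assms spectrum_bounds
  by (cases i; cases j) (simp_all del: spectrum.simps(3,4))

lemma white_noise_simple_eigenspace:
  assumes "spectrum i \<noteq> 0"
  shows "eigenspace white_noise_matrix (spectrum i) = span {eigenbasis i}"
proof -
  have "{j. spectrum j = spectrum i} = {i}"
    using spectrum_inj[OF assms] by blast
  then show ?thesis by (simp add: white_noise_eigenspace)
qed

lemma dim_white_noise_simple_eigenspace:
  assumes "spectrum i \<noteq> 0"
  shows "dim (eigenspace white_noise_matrix (spectrum i)) = 1"
proof -
  have "eigenbasis i \<noteq> 0"
    using eigenbasis_eigenvector by (simp add: eigenvector_def)
  then show ?thesis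
    by (simp add: white_noise_simple_eigenspace[OF assms] dim_insert)
qed

section \<open>The plane of the contrasts beta and delta\<close>

lemma span_nonzero_in_line:
  fixes u w :: "'a :: real_vector"
  assumes "u \<in> span {w}" "u \<noteq> 0"
  shows "span {u} = span {w}"
proof -
  obtain k where k: "u = k *\<^sub>R w" using assms(1) by (auto simp: span_singleton)
  with assms(2) have "w = (1 / k) *\<^sub>R u" by auto
  then have "w \<in> span {u}" by (metis span_base span_scale singletonI)
  with assms(1) show ?thesis by (simp add: span_eq)
qed

lemma beta_delta_plane:
  "span {eigenbasis P213, eigenbasis P231} = span {beta_vec, delta_vec}"
proof -
  let ?p = "eigenbasis P213" and ?q = "eigenbasis P231"
  \<comment> \<open>Solving \<open>p = \<surd>2 \<beta> - \<delta>\<close>, \<open>q = \<surd>2 \<beta> + \<delta>\<close> for \<open>\<beta>\<close> and \<open>\<delta>\<close>.\<close>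
  have "beta_vec = (1 / (2 * sqrt 2)) *\<^sub>R (?p + ?q)" "delta_vec = (1 / 2) *\<^sub>R (?q - ?p)"
    by (simp_all flip: scaleR_2)
  then have "beta_vec \<in> span {?p, ?q}" "delta_vec \<in> span {?p, ?q}"
    by (metis insertI1 insertI2 singletonI span_add span_base span_diff span_scale)+
  moreover have "?p \<in> span {beta_vec, delta_vec}" "?q \<in> span {beta_vec, delta_vec}"
    by (simp_all add: span_add span_base span_diff span_scale)
  ultimately show ?thesis by (simp add: span_eq)
qed

lemma span_eigenvectors_beta_delta:
  assumes "eigenvector white_noise_matrix u (spectrum P213)"
    and "eigenvector white_noise_matrix v (spectrum P231)"
  shows "span {u, v} = span {beta_vec, delta_vec}"
proof -
  have nz: "spectrum P213 \<noteq> 0" "spectrum P231 \<noteq> 0"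
    using spectrum_bounds by linarith+
  have "u \<in> span {eigenbasis P213}" "u \<noteq> 0" "v \<in> span {eigenbasis P231}" "v \<noteq> 0"
    using assms white_noise_simple_eigenspace[OF nz(1)] white_noise_simple_eigenspace[OF nz(2)]
    by (auto simp: eigenvector_def eigenspace_def)
  then have "span {u} = span {eigenbasis P213}" "span {v} = span {eigenbasis P231}"
    by (simp_all add: span_nonzero_in_line)
  then have "span ({u} \<union> {v}) = span ({eigenbasis P213} \<union> {eigenbasis P231})"
    by (simp only: span_Un)
  then show ?thesis using beta_delta_plane by (simp add: insert_commute)
qed

lemma dim_beta_delta: "dim (span {beta_vec, delta_vec}) = 2"
proof -
  have nz: "beta_vec \<noteq> 0" "delta_vec \<noteq> 0" "beta_vec \<noteq> delta_vec"
    by (simp_all add: pattern_coordinates)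
  have "independent {beta_vec, delta_vec}"
    using nz contrasts_inner(3)
    by (intro pairwise_orthogonal_independent)
      (auto simp: pairwise_insert orthogonal_def inner_commute)
  with nz(3) show ?thesis by (simp add: dim_eq_card_independent)
qed

section \<open>Correlations of the contrasts\<close>

lemma correlation_beta_delta:
  "correlation white_noise_matrix beta_vec delta_vec = - (sqrt 2 / 2)"
proof -
  have "covariance white_noise_matrix beta_vec beta_vec = 1 / 3"
    "covariance white_noise_matrix delta_vec delta_vec = 2 / 3"
    "covariance white_noise_matrix beta_vec delta_vec = - (1 / 3)"
    by (simp_all add: covariance_eq_inner white_noise_matrix_beta white_noise_matrix_delta
        inner_diff_right contrasts_inner inner_commute[of delta_vec beta_vec])
  moreover have "sqrt (1 / 3) * sqrt (2 / 3) = sqrt 2 / (3 :: real)"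
    by (simp add: real_sqrt_divide)
  ultimately have "correlation white_noise_matrix beta_vec delta_vec = - (1 / 3) / (sqrt 2 / 3)"
    by (simp only: correlation_def)
  also have "\<dots> = - (sqrt 2 / 2)"
  proof -
    have "sqrt 2 * (sqrt 2 / 2) = (1 :: real)" by simp
    then have "1 / sqrt 2 = sqrt 2 / (2 :: real)"
      by (metis div_by_0 nonzero_mult_div_cancel_left one_neq_zero times_divide_eq_right
          mult_zero_left)
    then show ?thesis by simp
  qed
  finally show ?thesis .
qed

text \<open>
  Every pair other than \<open>\<beta>, \<delta>\<close> contains \<open>\<tau>\<close> or \<open>\<gamma>\<close>, and these are eigenvectors orthogonal to the
  remaining contrasts.
\<close>

lemma uncorrelated_contrasts:
  assumes "x \<in> {beta_vec, tau_vec, gamma_vec, delta_vec}"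
    and "y \<in> {beta_vec, tau_vec, gamma_vec, delta_vec}"
    and "x \<noteq> y" "{x, y} \<noteq> {beta_vec, delta_vec}"
  shows "uncorrelated white_noise_matrix x y"
proof -
  have tau: "uncorrelated white_noise_matrix x tau_vec" if "x \<bullet> tau_vec = 0" for x
    using uncorrelated_eigenvector[OF eigenvector_tau that] .
  have gamma: "uncorrelated white_noise_matrix x gamma_vec" if "x \<bullet> gamma_vec = 0" for x
    using uncorrelated_eigenvector[OF eigenvector_gamma that] .
  note inner = contrasts_inner contrasts_inner[THEN trans[OF inner_commute]]
  note comm = uncorrelated_commute[OF transpose_white_noise_matrix]
  have "uncorrelated white_noise_matrix x y" if "y \<in> {tau_vec, gamma_vec}"
    using that assms(1,3) by (auto intro: tau gamma simp: inner)
  moreover have "uncorrelated white_noise_matrix y x" if "x \<in> {tau_vec, gamma_vec}"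
    using that assms(2,3) by (auto intro: tau gamma simp: inner)
  moreover have "x \<in> {tau_vec, gamma_vec} \<or> y \<in> {tau_vec, gamma_vec}"
    using assms by auto
  ultimately show ?thesis using comm by blast
qed

theorem proposition3:
  fixes T :: nat
    and Sigma_W M_W :: "real ^ pattern ^ pattern"
  assumes "T > 0"
    and "M_W = real T *\<^sub>R Sigma_W"
    and "M_W = white_noise_matrix"
  shows "eigenvector M_W tau_vec (2 / 15)
    \<and> eigenvector M_W gamma_vec (1 / 10)
    \<and> (\<exists>a b. distinct [2 / 15, 1 / 10, a, b]
          \<and> {c. c \<noteq> 0 \<and> eigenvalue M_W c} = {2 / 15, 1 / 10, a, b}
          \<and> (\<forall>c \<in> {2 / 15, 1 / 10, a, b}. dim (eigenspace M_W c) = 1)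
          \<and> (\<forall>u v. eigenvector M_W u a \<and> eigenvector M_W v b
                \<longrightarrow> span {u, v} = span {beta_vec, delta_vec}))
    \<and> dim (span {beta_vec, delta_vec}) = 2
    \<and> correlation M_W beta_vec delta_vec = - (sqrt 2 / 2)
    \<and> (\<forall>x \<in> {beta_vec, tau_vec, gamma_vec, delta_vec}.
        \<forall>y \<in> {beta_vec, tau_vec, gamma_vec, delta_vec}.
          x \<noteq> y \<and> {x, y} \<noteq> {beta_vec, delta_vec} \<longrightarrow> uncorrelated M_W x y)"
proof -
  let ?M = white_noise_matrix
  let ?a = "spectrum P213" and ?b = "spectrum P231"
  have distinct: "distinct [2 / 15, 1 / 10, ?a, ?b]"
    using spectrum_bounds by (auto simp del: spectrum.simps)
  have nz: "?a \<noteq> 0" "?b \<noteq> 0"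
    using spectrum_bounds by linarith+
  have "range spectrum = {2 / 15, 1 / 10, ?a, ?b, 0}"
    by (auto simp: UNIV_pattern)
  with nz have range: "range spectrum - {0} = {2 / 15, 1 / 10, ?a, ?b}"
    by (simp add: insert_Diff_if del: spectrum.simps)
  have "{c. c \<noteq> 0 \<and> eigenvalue ?M c} = range spectrum - {0}"
    using white_noise_eigenvalues by blast
  with range have nonzero: "{c. c \<noteq> 0 \<and> eigenvalue ?M c} = {2 / 15, 1 / 10, ?a, ?b}"
    by (rule trans[rotated])
  have lines: "\<forall>c \<in> {2 / 15, 1 / 10, ?a, ?b}. dim (eigenspace ?M c) = 1"
    unfolding range[symmetric] using dim_white_noise_simple_eigenspace by blast
  have plane: "\<forall>u v. eigenvector ?M u ?a \<and> eigenvector ?M v ?b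
      \<longrightarrow> span {u, v} = span {beta_vec, delta_vec}"
    using span_eigenvectors_beta_delta by blast
  have uncorrelated: "\<forall>x \<in> {beta_vec, tau_vec, gamma_vec, delta_vec}.
      \<forall>y \<in> {beta_vec, tau_vec, gamma_vec, delta_vec}.
        x \<noteq> y \<and> {x, y} \<noteq> {beta_vec, delta_vec} \<longrightarrow> uncorrelated ?M x y"
    by (intro ballI impI, elim conjE) (rule uncorrelated_contrasts)
  have "\<exists>a b. distinct [2 / 15, 1 / 10, a, b]
      \<and> {c. c \<noteq> 0 \<and> eigenvalue ?M c} = {2 / 15, 1 / 10, a, b}
      \<and> (\<forall>c \<in> {2 / 15, 1 / 10, a, b}. dim (eigenspace ?M c) = 1)
      \<and> (\<forall>u v. eigenvector ?M u a \<and> eigenvector ?M v b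
            \<longrightarrow> span {u, v} = span {beta_vec, delta_vec})"
    by (rule exI[of _ ?a], rule exI[of _ ?b]) (intro conjI distinct nonzero lines plane)
  then show ?thesis
    unfolding \<open>M_W = white_noise_matrix\<close>
    by (intro conjI eigenvector_tau eigenvector_gamma dim_beta_delta correlation_beta_delta
        uncorrelated)
qed

end
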